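(* Let $\mathbf{F}_q$ be a finite field with $q$ elements, let $n,m\geq 1$ be natural numbers with $m<q^n$, and let $>$ be a fixed monomial order (used both on $\mathbf{F}_q[\tau_1,\dots,\tau_n]$ and to order the set $M_q^n$ decreasingly). Let $\vec{X}=(\vec{x}_1,\dots,\vec{x}_m)\in(\mathbf{F}_q^n)^m$ be a tuple of $m$ different points of $\mathbf{F}_q^n$, let $X=\{\vec{x}_1,\dots,\vec{x}_m\}$, let $\vec{b}\in\mathbf{F}_q^m$, $d:=\dim F_n(\mathbf{F}_q)$ and $s:=\dim\ker(\Phi_{\vec{X}})$. Let $(u_1,\dots,u_s)$ be a cleaned kernel basis of $\ker(\Phi_{\vec{X}})\subseteq F_n(\mathbf{F}_q)$ with respect to the basis $(g_{nq\alpha})_{\alpha\in M_q^n}$, and let $(u_1,\dots,u_s,u_{s+1},\dots,u_d)$ be the basis of $F_n(\mathbf{F}_q)$ constructed from it by the standard orthonormalization, with $F_n(\mathbf{F}_q)$ endowed with the symmetric bilinear form for which this basis is orthonormal. Let $f\in\mathbf{F}_q[\tau_1,\dots,\tau_n]$ be a polynomial satisfying $\widetilde{f}(\vec{x}_j)=b_j$ for all $j\in\{1,\dots,m\}$. Let $U\subseteq I(X)$ be an arbitrary Gröbner basis of the vanishing ideal $I(X)$ with respect to $>$, and let $v^*\in F_n(\mathbf{F}_q)$ be the orthogonal solution of $\Phi_{\vec{X}}(g)=\vec{b}$. Then $$\varphi^{-1}(v^* )=\overline{f}^{U},$$ where $\overline{f}^{U}$ denotes the remainder (normal form) of $f$ on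 division by $U$ with respect to $>$.
   Context: $F_n(\mathbf{F}_q)$ is the $\mathbf{F}_q$-vector space of all functions $\mathbf{F}_q^n\to\mathbf{F}_q$. $M_q^n:=\{\alpha\in(\mathbb{N}_0)^n\mid \alpha_j<q \ \forall j\}$, listed decreasingly with respect to $>$ as $\alpha_1>\alpha_2>\dots>\alpha_{q^n}$. For $\alpha\in M_q^n$ the fundamental monomial function is $g_{nq\alpha}:\mathbf{F}_q^n\to\mathbf{F}_q$, $\vec{x}\mapsto\vec{x}^{\alpha}=x_1^{\alpha_1}\cdots x_n^{\alpha_n}$ (with $0^0=1$). The family $(g_{nq\alpha})_{\alpha\in M_q^n}$, ordered as $M_q^n$ is, is a basis of $F_n(\mathbf{F}_q)$. The evaluation epimorphism is the linear map $\Phi_{\vec{X}}:F_n(\mathbf{F}_q)\to\mathbf{F}_q^m$, $f\mapsto(f(\vec{x}_1),\dots,f(\vec{x}_m))^t$. $I(X)\subseteq\mathbf{F}_q[\tau_1,\dots,\tau_n]$ is the ideal of all polynomials vanishing at every point of $X$. $P_q^n(\mathbf{F}_q)$ is the space of polynomials of the form $\sum_{\alpha\in M_q^n}a_\alpha\tau_1^{\alpha_1}\cdots\tau_n^{\alpha_n}$. The map $\varphi:\mathbf{F}_q[\tau_1,\dots,\tau_n]\to F_n(\mathbf{F}_q)$ sends a polynomial to the function it defines. One writes $\widetilde{g}:=\varphi(g)$. The restriction of $\varphi$ to $P_q^n(\mathbf{F}_q)$ is a vector space isomorphism onto $F_n(\mathbf{F}_q)$, and $\varphi^{-1}:F_n(\mathbf{F}_q)\to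 P_q^n(\mathbf{F}_q)$ denotes the inverse of this restriction. Cleaned kernel basis: for a proper subspace $W$ of a finite-dimensional vector space $V$ with ordered basis $F$, a basis $(u_1,\dots,u_s)$ of $W$ is a cleaned kernel basis with respect to $F$ if the matrix whose rows are the coordinate vectors of $u_1,\dots,u_s$ with respect to $F$ is in reduced row echelon form. Standard orthonormalization: starting from a basis of $\ker(\Phi_{\vec{X}})$, form the $s\times d$ matrix whose rows are the coordinate vectors of the basis elements with respect to $(g_{nq\alpha})_{\alpha\in M_q^n}$, and bring it to reduced row echelon form $R$ (for a cleaned kernel basis the matrix is already $R$). The first $s$ elements of the new basis of $F_n(\mathbf{F}_q)$ are those with coordinate vectors the rows of $R$. The remaining elements $u_{s+1},\dots,u_d$ are those whose coordinate vectors are the canonical unit vectors $\vec{e}_j\in\mathbf{F}_q^d$ for which column $j$ of $R$ is not a pivot column. The symmetric bilinear form on $F_n(\mathbf{F}_q)$ is then defined by $\langle u_i,u_j\rangle:=\delta_{ij}$ for all $i,j\in\{1,\dots,d\}$. Orthogonal solution: a solution $v^*$ of $\Phi_{\vec{X}}(g)=\vec{b}$ is called an orthogonal solution if $\langle u,v^*\rangle=0$ for all $u\in\ker(\Phi_{\vec{X}})$. In the present setting it exists and is unique. *)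

theory Defs
  imports
    "HOL-Library.Cardinality"
    "HOL-Library.Poly_Mapping"
    "HOL-Library.Function_Algebras"
    "HOL-Library.While_Combinator"
    "Jordan_Normal_Form.Gauss_Jordan_Elimination"
begin

section \<open>Polynomials in finitely many variables and the functions they define\<close>

text \<open>The variables are indexed by a finite type \<open>'n\<close>; points of affine space are functions
  \<open>'n \<Rightarrow> 'a\<close>.\<close>

type_synonym 'n exponent = "'n \<Rightarrow>\<^sub>0 nat"
type_synonym ('n, 'a) mpoly = "'n exponent \<Rightarrow>\<^sub>0 'a"

definition monomial_function :: "'n::finite exponent \<Rightarrow> ('n \<Rightarrow> 'a::comm_ring_1) \<Rightarrow> 'a" where
  "monomial_function \<alpha> = (\<lambda>x. \<Prod>j\<in>UNIV. x j ^ Poly_Mapping.lookup \<alpha> j)"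

definition poly_function :: "('n::finite, 'a::comm_ring_1) mpoly \<Rightarrow> ('n \<Rightarrow> 'a) \<Rightarrow> 'a" where
  "poly_function p = (\<lambda>x. \<Sum>\<alpha>\<in>Poly_Mapping.keys p. Poly_Mapping.lookup p \<alpha> * monomial_function \<alpha> x)"

definition bounded_exponents :: "nat \<Rightarrow> 'n exponent set" where
  "bounded_exponents q = {\<alpha>. \<forall>j. Poly_Mapping.lookup \<alpha> j < q}"

definition bounded_polys :: "nat \<Rightarrow> ('n, 'a::zero) mpoly set" where
  "bounded_polys q = {p. Poly_Mapping.keys p \<subseteq> bounded_exponents q}"

definition poly_of_function ::
  "(('n::finite \<Rightarrow> 'a) \<Rightarrow> 'a) \<Rightarrow> ('n, 'a::{finite,field}) mpoly" where
  "poly_of_function = inv_into (bounded_polys CARD('a)) poly_function"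

definition vanishing_ideal :: "('n::finite \<Rightarrow> 'a) set \<Rightarrow> ('n, 'a::comm_ring_1) mpoly set" where
  "vanishing_ideal X = {p. \<forall>x\<in>X. poly_function p x = 0}"


section \<open>Monomial orders, Groebner bases and division with remainder\<close>

text \<open>Monomial orders are given by their strict part; \<open>gt \<alpha> \<beta>\<close> reads \<open>\<alpha> > \<beta>\<close>.\<close>

definition monomial_order :: "('n exponent \<Rightarrow> 'n exponent \<Rightarrow> bool) \<Rightarrow> bool" where
  "monomial_order gt \<longleftrightarrow>
     irreflp gt \<and> transp gt \<and> totalp gt \<and>
     (\<forall>\<alpha> \<beta> \<gamma>. gt \<alpha> \<beta> \<longrightarrow> gt (\<alpha> + \<gamma>) (\<beta> + \<gamma>)) \<and>
     wfp (\<lambda>\<alpha> \<beta>. gt \<beta> \<alpha>)"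

text \<open>The leading data are meaningful for nonzero polynomials only.\<close>

definition lead_exp :: "('n exponent \<Rightarrow> 'n exponent \<Rightarrow> bool) \<Rightarrow> ('n, 'a::zero) mpoly \<Rightarrow> 'n exponent" where
  "lead_exp gt p = (THE \<alpha>. \<alpha> \<in> Poly_Mapping.keys p \<and> (\<forall>\<beta>\<in>Poly_Mapping.keys p. \<beta> \<noteq> \<alpha> \<longrightarrow> gt \<alpha> \<beta>))"

definition lead_coef :: "('n exponent \<Rightarrow> 'n exponent \<Rightarrow> bool) \<Rightarrow> ('n, 'a::zero) mpoly \<Rightarrow> 'a" where
  "lead_coef gt p = Poly_Mapping.lookup p (lead_exp gt p)"

definition lead_term ::
  "('n exponent \<Rightarrow> 'n exponent \<Rightarrow> bool) \<Rightarrow> ('n, 'a::zero) mpoly \<Rightarrow> ('n, 'a) mpoly" where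
  "lead_term gt p = Poly_Mapping.single (lead_exp gt p) (lead_coef gt p)"

text \<open>A ring is a module over itself; the submodules are the ideals, so
  \<open>poly_ideal.span S\<close> is the ideal generated by \<open>S\<close>.\<close>

global_interpretation poly_ideal: Modules.module "(*) :: ('n, 'a::comm_ring_1) mpoly \<Rightarrow> _"
  by unfold_locales (simp_all add: algebra_simps)

definition groebner_basis ::
  "('n exponent \<Rightarrow> 'n exponent \<Rightarrow> bool) \<Rightarrow> ('n, 'a::field) mpoly set \<Rightarrow> ('n, 'a) mpoly set \<Rightarrow> bool" where
  "groebner_basis gt U I \<longleftrightarrow>
     finite U \<and> U \<subseteq> I \<and>
     poly_ideal.span (lead_term gt ` (U - {0})) = poly_ideal.span (lead_term gt ` (I - {0}))"

text \<open>One round of the division algorithm: \<open>p\<close> is the intermediate dividend and \<open>r\<close> the remainder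
  accumulated so far. Either the leading term of \<open>p\<close> is cancelled by the first divisor whose
  leading term divides it, or it is moved to the remainder.\<close>

definition division_step ::
  "('n exponent \<Rightarrow> 'n exponent \<Rightarrow> bool) \<Rightarrow> ('n, 'a::field) mpoly list \<Rightarrow>
   ('n, 'a) mpoly \<times> ('n, 'a) mpoly \<Rightarrow> ('n, 'a) mpoly \<times> ('n, 'a) mpoly" where
  "division_step gt us = (\<lambda>(p, r).
     case find (\<lambda>u. u \<noteq> 0 \<and> (\<forall>j. Poly_Mapping.lookup (lead_exp gt u) j \<le> Poly_Mapping.lookup (lead_exp gt p) j)) us of
       Some u \<Rightarrow>
         (p - Poly_Mapping.single (lead_exp gt p - lead_exp gt u) (lead_coef gt p / lead_coef gt u) * u, r)
     | None \<Rightarrow> (p - lead_term gt p, r + lead_term gt p))"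

definition division_remainder ::
  "('n exponent \<Rightarrow> 'n exponent \<Rightarrow> bool) \<Rightarrow> ('n, 'a::field) mpoly list \<Rightarrow> ('n, 'a) mpoly \<Rightarrow> ('n, 'a) mpoly" where
  "division_remainder gt us f = snd (while (\<lambda>(p, r). p \<noteq> 0) (division_step gt us) (f, 0))"


section \<open>Vector spaces of functions\<close>

definition fscale :: "'a::field \<Rightarrow> ('b \<Rightarrow> 'a) \<Rightarrow> 'b \<Rightarrow> 'a" where
  "fscale c f = (\<lambda>x. c * f x)"

global_interpretation fun_space: vector_space "fscale :: 'a::field \<Rightarrow> ('b \<Rightarrow> 'a) \<Rightarrow> 'b \<Rightarrow> 'a"
  by unfold_locales (simp_all add: fscale_def fun_eq_iff algebra_simps)

definition evaluation :: "('m \<Rightarrow> 'p) \<Rightarrow> ('p \<Rightarrow> 'a) \<Rightarrow> 'm \<Rightarrow> 'a" where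
  "evaluation X f = (\<lambda>i. f (X i))"

definition evaluation_kernel :: "('m \<Rightarrow> 'p) \<Rightarrow> ('p \<Rightarrow> 'a::zero) set" where
  "evaluation_kernel X = {f. evaluation X f = 0}"

text \<open>Ordered bases are lists. The rows of the coordinate matrix are the coordinate vectors of \<open>us\<close>
  with respect to the ordered basis \<open>F\<close>.\<close>

definition ordered_basis :: "('b \<Rightarrow> 'a::field) list \<Rightarrow> ('b \<Rightarrow> 'a) set \<Rightarrow> bool" where
  "ordered_basis us W \<longleftrightarrow>
     distinct us \<and> fun_space.independent (set us) \<and> fun_space.span (set us) = W"

definition coord_matrix :: "('b \<Rightarrow> 'a::field) list \<Rightarrow> ('b \<Rightarrow> 'a) list \<Rightarrow> 'a mat" where
  "coord_matrix F us =
     mat (length us) (length F) (\<lambda>(i, j). fun_space.representation (set F) (us ! i) (F ! j))"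

text \<open>The library's \<open>row_echelon_form\<close> is the reduced one: pivots are 1 and are the only nonzero
  entries of their columns.\<close>

definition cleaned_kernel_basis ::
  "('b \<Rightarrow> 'a::field) list \<Rightarrow> ('b \<Rightarrow> 'a) set \<Rightarrow> ('b \<Rightarrow> 'a) list \<Rightarrow> bool" where
  "cleaned_kernel_basis F W us \<longleftrightarrow> ordered_basis us W \<and> row_echelon_form (coord_matrix F us)"

definition pivot_columns :: "'a::zero mat \<Rightarrow> nat set" where
  "pivot_columns R =
     {j. j < dim_col R \<and> (\<exists>i<dim_row R. R $$ (i, j) \<noteq> 0 \<and> (\<forall>k<j. R $$ (i, k) = 0))}"

text \<open>The element whose coordinate vector is the \<open>j\<close>-th unit vector is \<open>F ! j\<close>.\<close>

definition standard_extension ::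
  "('b \<Rightarrow> 'a::field) list \<Rightarrow> ('b \<Rightarrow> 'a) list \<Rightarrow> ('b \<Rightarrow> 'a) list" where
  "standard_extension F us =
     us @ [F ! j. j \<leftarrow> [0..<length F], j \<notin> pivot_columns (coord_matrix F us)]"

definition symmetric_bilinear_form ::
  "(('b \<Rightarrow> 'a::field) \<Rightarrow> ('b \<Rightarrow> 'a) \<Rightarrow> 'a) \<Rightarrow> bool" where
  "symmetric_bilinear_form B \<longleftrightarrow>
     (\<forall>g. Vector_Spaces.linear fscale (*) (\<lambda>f. B f g)) \<and> (\<forall>f g. B f g = B g f)"

definition orthonormal_list ::
  "(('b \<Rightarrow> 'a::field) \<Rightarrow> ('b \<Rightarrow> 'a) \<Rightarrow> 'a) \<Rightarrow> ('b \<Rightarrow> 'a) list \<Rightarrow> bool" where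
  "orthonormal_list B ws \<longleftrightarrow>
     (\<forall>i<length ws. \<forall>j<length ws. B (ws ! i) (ws ! j) = (if i = j then 1 else 0))"

definition orthogonal_solution ::
  "(('p \<Rightarrow> 'a::field) \<Rightarrow> ('p \<Rightarrow> 'a) \<Rightarrow> 'a) \<Rightarrow> ('m \<Rightarrow> 'p) \<Rightarrow> ('m \<Rightarrow> 'a) \<Rightarrow> ('p \<Rightarrow> 'a) \<Rightarrow> bool" where
  "orthogonal_solution B X b v \<longleftrightarrow>
     evaluation X v = b \<and> (\<forall>u\<in>evaluation_kernel X. B u v = 0)"

end

theory Submission
  imports Defs
begin

text \<open>The remainder \<open>r\<close> of \<open>f\<close> has no exponent divisible by a leading exponent of the vanishing
  ideal. Since the ideal contains \<open>\<tau>\<^sub>j\<^sup>q - \<tau>\<^sub>j\<close>, \<open>r\<close> is a reduced polynomial, and it suffices to show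
  that the function of \<open>r\<close> is \<open>v\<close>. A pivot column of the coordinate matrix of the kernel basis is the
  leading exponent of an element of the ideal, so only non-pivot columns occur in \<open>r\<close>; by
  orthonormality \<open>r\<close> is orthogonal to the kernel. The difference of \<open>v\<close> and \<open>r\<close> then lies in the kernel
  and is orthogonal to it, hence vanishes, as the kernel has an orthonormal basis.\<close>

section \<open>Evaluation of polynomials\<close>

lemma poly_function_superset:
  assumes "finite A" "Poly_Mapping.keys p \<subseteq> A"
  shows "poly_function p x = (\<Sum>\<alpha>\<in>A. Poly_Mapping.lookup p \<alpha> * monomial_function \<alpha> x)"
  unfolding poly_function_def
  using assms by (intro sum.mono_neutral_left) (auto simp: in_keys_iff)

lemma poly_function_0 [simp]: "poly_function 0 x = 0"
  by (simp add: poly_function_def)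

lemma poly_function_single [simp]:
  "poly_function (Poly_Mapping.single \<alpha> c) x = c * monomial_function \<alpha> x"
  by (subst poly_function_superset[of "{\<alpha>}"]) auto

lemma poly_function_add: "poly_function (p + q) x = poly_function p x + poly_function q x"
proof -
  let ?A = "Poly_Mapping.keys p \<union> Poly_Mapping.keys q"
  have "Poly_Mapping.keys (p + q) \<subseteq> ?A"
    by (rule Poly_Mapping.keys_add)
  then show ?thesis
    by (simp add: poly_function_superset[of ?A] lookup_add distrib_right sum.distrib)
qed

lemma poly_function_sum:
  "poly_function (\<Sum>i\<in>A. p i) x = (\<Sum>i\<in>A. poly_function (p i) x)"
  by (induction A rule: infinite_finite_induct) (simp_all add: poly_function_add)

lemma poly_mapping_sum_single:
  "(\<Sum>\<alpha>\<in>Poly_Mapping.keys p. Poly_Mapping.single \<alpha> (Poly_Mapping.lookup p \<alpha>)) = p"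
  by (rule poly_mapping_eqI) (auto simp: lookup_sum lookup_single when_def in_keys_iff)

lemma monomial_function_add:
  "monomial_function (\<alpha> + \<beta>) x = monomial_function \<alpha> x * monomial_function \<beta> x"
  by (simp add: monomial_function_def lookup_add power_add prod.distrib)

lemma poly_function_mult: "poly_function (p * q) x = poly_function p x * poly_function q x"
proof -
  have "poly_function (p * q) x =
    poly_function ((\<Sum>\<alpha>\<in>Poly_Mapping.keys p. Poly_Mapping.single \<alpha> (Poly_Mapping.lookup p \<alpha>)) *
      (\<Sum>\<beta>\<in>Poly_Mapping.keys q. Poly_Mapping.single \<beta> (Poly_Mapping.lookup q \<beta>))) x"
    by (simp only: poly_mapping_sum_single)
  also have "\<dots> = poly_function p x * poly_function q x"
    by (simp add: poly_function_def[of p] poly_function_def[of q] sum_product mult_single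
        poly_function_sum monomial_function_add algebra_simps)
  finally show ?thesis .
qed

lemma poly_function_diff: "poly_function (p - q) x = poly_function p x - poly_function q x"
  using poly_function_add[of "p - q" q x] by simp

text \<open>A submodule of the ring over itself is an ideal, so subtracting multiples of its members
  preserves the residue class.\<close>

lemma subspace_vanishing_ideal: "poly_ideal.subspace (vanishing_ideal X)"
  by (auto simp: poly_ideal.subspace_def vanishing_ideal_def poly_function_add poly_function_mult)


section \<open>Reduced polynomials over a finite field\<close>

text \<open>Multiplication by a nonzero \<open>x\<close> permutes the nonzero elements, so their
  product absorbs the factor \<open>x ^ (CARD('a) - 1)\<close>; that product is nonzero and
  cancels.\<close>

lemma finite_field_power_card_eq_same: "x ^ CARD('a) = (x :: 'a::{finite,field})"
proof (cases "x = 0")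
  case False
  let ?P = "\<Prod>y\<in>UNIV - {0 :: 'a}. y"
  have "bij_betw ((*) x) (UNIV - {0}) (UNIV - {0})"
    by (rule bij_betw_byWitness[where f' = "\<lambda>y. y / x"]) (use False in auto)
  then have "?P = (\<Prod>y\<in>UNIV - {0}. x * y)"
    by (rule prod.reindex_bij_betw[symmetric])
  also have "\<dots> = x ^ (CARD('a) - 1) * ?P"
    by (simp add: prod.distrib)
  finally have "x ^ (CARD('a) - 1) = 1"
    by simp
  moreover have "x ^ CARD('a) = x * x ^ (CARD('a) - 1)"
    by (rule power_eq_if[THEN trans]) simp
  ultimately show ?thesis
    by simp
qed simp

lemma card_field_gt_1: "1 < CARD('a::{finite,field})"
proof -
  have "card {0, 1 :: 'a} \<le> CARD('a)"
    by (rule card_mono) auto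
  then show ?thesis
    by simp
qed

lemma power_card_minus_1: "(x :: 'a::{finite,field}) ^ (CARD('a) - 1) = (if x = 0 then 0 else 1)"
proof -
  have "x * x ^ (CARD('a) - 1) = x"
    using finite_field_power_card_eq_same[of x] card_field_gt_1[where 'a = 'a]
    by (simp add: power_eq_if)
  then show ?thesis
    using card_field_gt_1[where 'a = 'a] by auto
qed

text \<open>With \<open>q = CARD('a)\<close>, the indicator of \<open>a\<close> is
  \<open>1 - (x - a) ^ (q - 1)\<close>, because a \<open>(q - 1)\<close>-th power is 0 at 0 and 1
  elsewhere.\<close>

lemma point_indicator_power_sum:
  fixes a :: "'a::{finite,field}"
  obtains c where "\<And>x. (\<Sum>k<CARD('a). c k * x ^ k) = (if x = a then 1 else 0)"
proof -
  let ?q = "CARD('a)"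
  \<comment> \<open>Binomial coefficients of \<open>1 - (x - a) ^ (q - 1)\<close>; the constant 1
    contributes only at \<open>k = 0\<close>.\<close>
  define c where "c k = (if k = 0 then 1 else 0) - of_nat ((?q - 1) choose k) * (- a) ^ (?q - 1 - k)" for k
  have q: "{..<?q} = {..?q - 1}"
    using card_field_gt_1[where 'a = 'a] by auto
  have "(\<Sum>k<?q. c k * x ^ k) = (if x = a then 1 else 0)" for x
  proof -
    have "(\<Sum>k<?q. c k * x ^ k) =
        (\<Sum>k<?q. (if k = 0 then 1 else 0) * x ^ k) -
        (\<Sum>k<?q. of_nat ((?q - 1) choose k) * x ^ k * (- a) ^ (?q - 1 - k))"
      unfolding c_def left_diff_distrib sum_subtractf by (simp only: mult_ac)
    also have "(\<Sum>k<?q. (if k = 0 then 1 else 0) * x ^ k) = 1"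
      using card_field_gt_1[where 'a = 'a] by (simp add: if_distrib[of "\<lambda>y. y * _"] cong: if_cong)
    also have "(\<Sum>k<?q. of_nat ((?q - 1) choose k) * x ^ k * (- a) ^ (?q - 1 - k)) = (x - a) ^ (?q - 1)"
      using binomial_ring[of x "- a" "?q - 1"] by (simp add: q)
    finally show ?thesis
      unfolding power_card_minus_1 by simp
  qed
  then show thesis
    by (rule that)
qed

section \<open>Bounded exponents and reduced polynomials\<close>

lemma bij_betw_lookup_bounded_exponents:
  "bij_betw Poly_Mapping.lookup (bounded_exponents q :: 'n::finite exponent set) (UNIV \<rightarrow>\<^sub>E {..<q})"
  \<comment> \<open>Every function on the finite type of variables has finite support, so
    \<open>Abs_poly_mapping\<close> inverts \<open>lookup\<close>.\<close>
  by (rule bij_betw_byWitness[where f' = Abs_poly_mapping])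
     (auto simp: bounded_exponents_def PiE_UNIV_domain lookup_inverse)

lemma finite_bounded_exponents [simp]: "finite (bounded_exponents q :: 'n::finite exponent set)"
  using bij_betw_finite[OF bij_betw_lookup_bounded_exponents[of q, where 'n = 'n]]
  by (simp add: finite_PiE)

lemma card_bounded_exponents: "card (bounded_exponents q :: 'n::finite exponent set) = q ^ CARD('n)"
  using bij_betw_same_card[OF bij_betw_lookup_bounded_exponents[of q, where 'n = 'n]]
  by (simp add: card_PiE)

text \<open>The coefficients are a total function whose values outside the bounded exponents are
  ignored, so no support condition has to be carried along.\<close>

definition poly_of_coeffs ::
  "('n exponent \<Rightarrow> 'a) \<Rightarrow> ('n::finite, 'a::{finite,field}) mpoly" where
  "poly_of_coeffs c = (\<Sum>\<alpha>\<in>bounded_exponents CARD('a). Poly_Mapping.single \<alpha> (c \<alpha>))"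

lemma lookup_poly_of_coeffs:
  fixes c :: "'n::finite exponent \<Rightarrow> 'a::{finite,field}"
  shows "Poly_Mapping.lookup (poly_of_coeffs c) \<alpha> = (if \<alpha> \<in> bounded_exponents CARD('a) then c \<alpha> else 0)"
  by (auto simp: poly_of_coeffs_def lookup_sum lookup_single when_def)

lemma poly_of_coeffs_in_bounded_polys:
  fixes c :: "'n::finite exponent \<Rightarrow> 'a::{finite,field}"
  shows "poly_of_coeffs c \<in> bounded_polys CARD('a)"
  by (auto simp: bounded_polys_def in_keys_iff lookup_poly_of_coeffs split: if_splits)

lemma poly_function_poly_of_coeffs:
  fixes c :: "'n::finite exponent \<Rightarrow> 'a::{finite,field}"
  shows "poly_function (poly_of_coeffs c) x =
    (\<Sum>\<alpha>\<in>bounded_exponents CARD('a). c \<alpha> * monomial_function \<alpha> x)"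
  by (simp add: poly_of_coeffs_def poly_function_sum)

text \<open>Extensional functions give a finite index set of known size, which serves both
  finiteness and the count behind injectivity.\<close>

lemma bounded_polys_eq_image:
  "(bounded_polys CARD('a) :: ('n::finite, 'a::{finite,field}) mpoly set) =
   poly_of_coeffs ` (bounded_exponents CARD('a) \<rightarrow>\<^sub>E UNIV)"
proof (intro equalityI subsetI)
  fix p :: "('n, 'a) mpoly"
  assume "p \<in> bounded_polys CARD('a)"
  then have "p = poly_of_coeffs (restrict (Poly_Mapping.lookup p) (bounded_exponents CARD('a)))"
    by (intro poly_mapping_eqI) (auto simp: lookup_poly_of_coeffs bounded_polys_def in_keys_iff)
  then show "p \<in> poly_of_coeffs ` (bounded_exponents CARD('a) \<rightarrow>\<^sub>E UNIV)"
    by (rule image_eqI[where f = poly_of_coeffs]) auto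
qed (auto simp: poly_of_coeffs_in_bounded_polys)

lemma finite_bounded_polys:
  "finite (bounded_polys CARD('a) :: ('n::finite, 'a::{finite,field}) mpoly set)"
  unfolding bounded_polys_eq_image by (intro finite_imageI finite_PiE) auto

text \<open>Multiply the one-variable indicators of \<open>a j\<close> over all coordinates
  \<open>j\<close>. Each factor has degree below \<open>q\<close>, so the expanded product involves
  only bounded exponents.\<close>

lemma point_indicator_poly:
  fixes a :: "'n::finite \<Rightarrow> 'a::{finite,field}"
  obtains c where "\<And>x. poly_function (poly_of_coeffs c) x = (if x = a then 1 else 0)"
proof -
  let ?q = "CARD('a)"
  have "\<exists>c. \<forall>x. (\<Sum>k<?q. c k * x ^ k) = (if x = y then 1 else 0)" for y :: 'a
    by (metis point_indicator_power_sum)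
  then obtain c where c: "\<And>y x :: 'a. (\<Sum>k<?q. c y k * x ^ k) = (if x = y then 1 else 0)"
    by metis
  let ?C = "\<lambda>\<alpha>. \<Prod>j\<in>UNIV. c (a j) (Poly_Mapping.lookup \<alpha> j)"
  have "poly_function (poly_of_coeffs ?C) x = (if x = a then 1 else 0)" for x
  proof -
    have "poly_function (poly_of_coeffs ?C) x =
        (\<Sum>\<alpha>\<in>bounded_exponents ?q.
          (\<lambda>g. \<Prod>j\<in>UNIV. c (a j) (g j) * x j ^ g j) (Poly_Mapping.lookup \<alpha>))"
      by (simp add: poly_function_poly_of_coeffs monomial_function_def prod.distrib)
    also have "\<dots> = (\<Sum>g\<in>UNIV \<rightarrow>\<^sub>E {..<?q}. \<Prod>j\<in>UNIV. c (a j) (g j) * x j ^ g j)"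
      by (rule sum.reindex_bij_betw[OF bij_betw_lookup_bounded_exponents])
    also have "\<dots> = (\<Prod>j\<in>UNIV. \<Sum>k<?q. c (a j) k * x j ^ k)"
      by (rule prod_sum_PiE[symmetric]) auto
    also have "\<dots> = (if x = a then 1 else 0)"
      by (auto simp: c fun_eq_iff)
    finally show ?thesis .
  qed
  then show thesis
    by (rule that)
qed

text \<open>Lagrange interpolation: \<open>f\<close> is the sum of the point indicators weighted by
  the values \<open>f a\<close>.\<close>

lemma poly_function_surj:
  "poly_function ` (bounded_polys CARD('a) :: ('n::finite, 'a::{finite,field}) mpoly set) = UNIV"
proof -
  have "\<exists>c. \<forall>x. poly_function (poly_of_coeffs c) x = (if x = a then 1 else 0)" for a :: "'n \<Rightarrow> 'a"
    by (metis point_indicator_poly)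
  then obtain c where c: "\<And>a x :: 'n \<Rightarrow> 'a.
      poly_function (poly_of_coeffs (c a)) x = (if x = a then 1 else 0)"
    by metis
  have "f = poly_function (poly_of_coeffs (\<lambda>\<alpha>. \<Sum>a\<in>UNIV. f a * c a \<alpha>))" for f :: "('n \<Rightarrow> 'a) \<Rightarrow> 'a"
  proof
    fix x
    have "poly_function (poly_of_coeffs (\<lambda>\<alpha>. \<Sum>a\<in>UNIV. f a * c a \<alpha>)) x =
        (\<Sum>a\<in>UNIV. f a * poly_function (poly_of_coeffs (c a)) x)"
      by (simp add: poly_function_poly_of_coeffs sum_distrib_right sum_distrib_left mult.assoc)
         (rule sum.swap)
    then show "f x = poly_function (poly_of_coeffs (\<lambda>\<alpha>. \<Sum>a\<in>UNIV. f a * c a \<alpha>)) x"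
      by (simp add: c if_distrib[of "\<lambda>y. _ * y"] cong: if_cong)
  qed
  then show ?thesis
    using poly_of_coeffs_in_bounded_polys by blast
qed

text \<open>There are at most \<open>q ^ (q ^ n)\<close> reduced polynomials in \<open>n\<close>
  variables, and they map onto that many functions; by finiteness the map is injective.\<close>

lemma poly_function_inj:
  "inj_on poly_function (bounded_polys CARD('a) :: ('n::finite, 'a::{finite,field}) mpoly set)"
proof (rule eq_card_imp_inj_on[OF finite_bounded_polys])
  let ?P = "bounded_polys CARD('a) :: ('n, 'a) mpoly set"
  have "card ?P \<le> card (bounded_exponents CARD('a) \<rightarrow>\<^sub>E (UNIV :: 'a set) :: ('n exponent \<Rightarrow> 'a) set)"
    unfolding bounded_polys_eq_image by (intro card_image_le finite_PiE) auto
  also have "\<dots> = card (UNIV :: (('n \<Rightarrow> 'a) \<Rightarrow> 'a) set)"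
    by (simp add: card_PiE card_fun card_bounded_exponents)
  finally have "card ?P \<le> card (poly_function ` ?P)"
    by (simp add: poly_function_surj)
  then show "card (poly_function ` ?P) = card ?P"
    by (intro antisym card_image_le finite_bounded_polys)
qed

lemma poly_of_function_poly_function:
  fixes p :: "('n::finite, 'a::{finite,field}) mpoly"
  shows "p \<in> bounded_polys CARD('a) \<Longrightarrow> poly_of_function (poly_function p) = p"
  unfolding poly_of_function_def by (rule inv_into_f_f[OF poly_function_inj])

lemma poly_of_coeffs_eq_0_D:
  fixes c :: "'n::finite exponent \<Rightarrow> 'a::{finite,field}"
  assumes "\<And>x. poly_function (poly_of_coeffs c) x = 0" "\<alpha> \<in> bounded_exponents CARD('a)"
  shows "c \<alpha> = 0"
proof -
  have "poly_of_coeffs c = 0"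
    by (rule inj_onD[OF poly_function_inj])
       (use assms(1) poly_of_coeffs_in_bounded_polys[of c] in \<open>simp_all add: bounded_polys_def fun_eq_iff\<close>)
  then show ?thesis
    using lookup_poly_of_coeffs[of c \<alpha>] assms(2) by simp
qed

section \<open>Monomial functions as a basis of the function space\<close>

lemma inj_on_monomial_function:
  "inj_on (monomial_function :: 'n::finite exponent \<Rightarrow> ('n \<Rightarrow> 'a::{finite,field}) \<Rightarrow> 'a)
    (bounded_exponents CARD('a))"
proof (rule inj_onI)
  fix \<alpha> \<beta> :: "'n exponent"
  assume *: "\<alpha> \<in> bounded_exponents CARD('a)" "\<beta> \<in> bounded_exponents CARD('a)"
    "monomial_function \<alpha> = (monomial_function \<beta> :: ('n \<Rightarrow> 'a) \<Rightarrow> 'a)"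
  then have "Poly_Mapping.single \<alpha> (1 :: 'a) = Poly_Mapping.single \<beta> 1"
    by (intro inj_onD[OF poly_function_inj]) (auto simp: bounded_polys_def fun_eq_iff)
  then show "\<alpha> = \<beta>"
    by (metis keys_single singleton_inject zero_neq_one)
qed

lemma sum_fun_apply: "(\<Sum>i\<in>A. f i) x = (\<Sum>i\<in>A. f i x)"
  by (induction A rule: infinite_finite_induct) auto

text \<open>Linear dependence and \<open>representation\<close> index scalars by the basis functions
  themselves; this turns such scalars into coefficients of a reduced polynomial.\<close>

lemma poly_function_poly_of_coeffs_image:
  fixes u :: "(('n::finite \<Rightarrow> 'a::{finite,field}) \<Rightarrow> 'a) \<Rightarrow> 'a"
  shows "poly_function (poly_of_coeffs (\<lambda>\<alpha>. u (monomial_function \<alpha>))) =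
    (\<Sum>g\<in>monomial_function ` bounded_exponents CARD('a). fscale (u g) g)"
  by (simp add: fun_eq_iff poly_function_poly_of_coeffs sum_fun_apply fscale_def
      sum.reindex[OF inj_on_monomial_function])

lemma independent_monomial_functions:
  "fun_space.independent (monomial_function ` bounded_exponents CARD('a) ::
    (('n::finite \<Rightarrow> 'a::{finite,field}) \<Rightarrow> 'a) set)"
proof -
  have "u (monomial_function \<alpha>) = 0"
    if "(\<Sum>g\<in>monomial_function ` bounded_exponents CARD('a). fscale (u g) g) = 0"
      "\<alpha> \<in> bounded_exponents CARD('a)"
    for u :: "(('n \<Rightarrow> 'a) \<Rightarrow> 'a) \<Rightarrow> 'a" and \<alpha>
    by (rule poly_of_coeffs_eq_0_D[where c = "\<lambda>\<alpha>. u (monomial_function \<alpha>)"])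
       (use that in \<open>simp_all add: poly_function_poly_of_coeffs_image\<close>)
  then show ?thesis
    by (subst fun_space.dependent_finite) auto
qed

lemma span_monomial_functions:
  "fun_space.span (monomial_function ` bounded_exponents CARD('a)) =
    (UNIV :: (('n::finite \<Rightarrow> 'a::{finite,field}) \<Rightarrow> 'a) set)"
proof -
  have "f \<in> fun_space.span (monomial_function ` bounded_exponents CARD('a))"
    for f :: "('n \<Rightarrow> 'a) \<Rightarrow> 'a"
  proof -
    obtain c where "f = poly_function (poly_of_coeffs c)"
      using poly_function_surj bounded_polys_eq_image by (metis (no_types, lifting) UNIV_I imageE)
    then have "f = (\<Sum>\<alpha>\<in>bounded_exponents CARD('a). fscale (c \<alpha>) (monomial_function \<alpha>))"
      by (simp add: fun_eq_iff poly_function_poly_of_coeffs sum_fun_apply fscale_def)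
    then show ?thesis
      by (simp add: fun_space.span_sum fun_space.span_scale fun_space.span_base)
  qed
  then show ?thesis
    by auto
qed


section \<open>Leading exponents and division with remainder\<close>

abbreviation exp_dvd :: "'n exponent \<Rightarrow> 'n exponent \<Rightarrow> bool" where
  "exp_dvd \<alpha> \<beta> \<equiv> \<forall>j. Poly_Mapping.lookup \<alpha> j \<le> Poly_Mapping.lookup \<beta> j"

text \<open>Subtraction of exponents truncates at 0 in each variable; divisibility makes it
  exact.\<close>

lemma exp_dvd_imp_add: "exp_dvd \<alpha> \<beta> \<Longrightarrow> (\<beta> - \<alpha>) + \<alpha> = \<beta>"
  by (rule poly_mapping_eqI) (simp add: lookup_add lookup_minus)

text \<open>Multiplying a generator by any polynomial only raises its exponent, and addition creates
  no new monomials. This is the membership criterion for monomial ideals.\<close>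

lemma keys_span_single_exp_dvd:
  assumes "p \<in> poly_ideal.span ((\<lambda>i. Poly_Mapping.single (e i) (c i)) ` A)" "\<beta> \<in> Poly_Mapping.keys p"
  shows "\<exists>i\<in>A. exp_dvd (e i) \<beta>"
  using assms
proof (induction arbitrary: \<beta> rule: poly_ideal.span_induct_alt)
  case (step r x p)
  from step.prems consider "\<beta> \<in> Poly_Mapping.keys (r * x)" | "\<beta> \<in> Poly_Mapping.keys p"
    using Poly_Mapping.keys_add[of "r * x" p] by auto
  then show ?case
  proof cases
    case 1
    with keys_mult[of r x] obtain \<gamma> \<delta> where \<beta>: "\<beta> = \<gamma> + \<delta>" and \<delta>: "\<delta> \<in> Poly_Mapping.keys x"
      by blast
    from step.hyps \<delta> obtain i where "i \<in> A" "\<delta> = e i"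
      by (auto split: if_splits)
    then show ?thesis
      by (intro bexI[of _ i]) (simp_all add: \<beta> lookup_add)
  qed (rule step.IH)
qed simp

lemma lookup_single_mult:
  fixes p :: "('n, 'a::comm_ring_1) mpoly"
  shows "Poly_Mapping.lookup (Poly_Mapping.single \<alpha> c * p) (\<alpha> + \<beta>) = c * Poly_Mapping.lookup p \<beta>"
proof -
  have "Poly_Mapping.lookup (Poly_Mapping.single \<alpha> c * p) (\<alpha> + \<beta>) =
     Poly_Mapping.lookup (Poly_Mapping.single \<alpha> c *
       (\<Sum>\<gamma>\<in>Poly_Mapping.keys p. Poly_Mapping.single \<gamma> (Poly_Mapping.lookup p \<gamma>))) (\<alpha> + \<beta>)"
    by (simp only: poly_mapping_sum_single)
  also have "\<dots> = c * Poly_Mapping.lookup p \<beta>"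
    by (auto simp: sum_distrib_left mult_single lookup_sum lookup_single when_def in_keys_iff
        cong: if_cong)
  finally show ?thesis .
qed

section \<open>Monomial orders and leading exponents\<close>

context
  fixes gt :: "'n::finite exponent \<Rightarrow> 'n exponent \<Rightarrow> bool"
  assumes order: "monomial_order gt"
begin

lemma gt_irrefl: "\<not> gt \<alpha> \<alpha>"
  using order by (auto simp: monomial_order_def irreflp_def)

lemma gt_trans: "gt \<alpha> \<beta> \<Longrightarrow> gt \<beta> \<gamma> \<Longrightarrow> gt \<alpha> \<gamma>"
  using order unfolding monomial_order_def by (meson transpD)

lemma gt_total: "\<alpha> \<noteq> \<beta> \<Longrightarrow> gt \<alpha> \<beta> \<or> gt \<beta> \<alpha>"
  using order by (auto simp: monomial_order_def totalp_on_def)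

lemma gt_add: "gt \<alpha> \<beta> \<Longrightarrow> gt (\<alpha> + \<gamma>) (\<beta> + \<gamma>)"
  using order by (auto simp: monomial_order_def)

lemma wf_gt: "wf {(\<beta>, \<alpha>). gt \<alpha> \<beta>}"
  using order by (simp add: monomial_order_def wfp_def)

text \<open>If \<alpha> were below 0, translation would put \<open>\<alpha> + \<gamma>\<close> below
  every \<gamma>, so no exponent could be minimal, against well-foundedness.\<close>

lemma gt_zero:
  assumes "\<alpha> \<noteq> 0"
  shows "gt \<alpha> 0"
proof (rule ccontr)
  assume "\<not> gt \<alpha> 0"
  with gt_total assms have "gt 0 \<alpha>"
    by blast
  then have "gt \<gamma> (\<alpha> + \<gamma>)" for \<gamma>
    using gt_add[of 0 \<alpha> \<gamma>] by simp
  moreover obtain z where "\<And>y. (y, z) \<in> {(\<beta>, \<alpha>). gt \<alpha> \<beta>} \<Longrightarrow> y \<notin> UNIV"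
    using wfE_min[OF wf_gt UNIV_I] by blast
  ultimately show False
    by blast
qed

lemma finite_has_gt_max:
  "finite A \<Longrightarrow> A \<noteq> {} \<Longrightarrow> \<exists>\<alpha>\<in>A. \<forall>\<beta>\<in>A. \<beta> \<noteq> \<alpha> \<longrightarrow> gt \<alpha> \<beta>"
proof (induction A rule: finite_ne_induct)
  case (insert x A)
  then obtain \<alpha> where \<alpha>: "\<alpha> \<in> A" "\<forall>\<beta>\<in>A. \<beta> \<noteq> \<alpha> \<longrightarrow> gt \<alpha> \<beta>"
    by blast
  show ?case
  proof (cases "gt x \<alpha>")
    case True
    with \<alpha> have "\<forall>\<beta>\<in>insert x A. \<beta> \<noteq> x \<longrightarrow> gt x \<beta>"
      by (metis gt_trans insert_iff)
    then show ?thesis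
      by blast
  next
    case False
    with \<alpha> have "\<forall>\<beta>\<in>insert x A. \<beta> \<noteq> \<alpha> \<longrightarrow> gt \<alpha> \<beta>"
      by (metis gt_total insert_iff)
    with \<alpha>(1) show ?thesis
      by blast
  qed
qed simp

lemma lead_exp_eqI:
  assumes "\<alpha> \<in> Poly_Mapping.keys p" "\<And>\<beta>. \<beta> \<in> Poly_Mapping.keys p \<Longrightarrow> \<beta> \<noteq> \<alpha> \<Longrightarrow> gt \<alpha> \<beta>"
  shows "lead_exp gt p = \<alpha>"
  unfolding lead_exp_def
proof (rule the_equality)
  show "\<gamma> = \<alpha>" if "\<gamma> \<in> Poly_Mapping.keys p \<and> (\<forall>\<beta>\<in>Poly_Mapping.keys p. \<beta> \<noteq> \<gamma> \<longrightarrow> gt \<gamma> \<beta>)" for \<gamma>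
    using that assms by (metis gt_trans gt_irrefl)
qed (use assms in blast)

lemma lead_exp_in_keys: "p \<noteq> 0 \<Longrightarrow> lead_exp gt p \<in> Poly_Mapping.keys p"
  and gt_lead_exp: "p \<noteq> 0 \<Longrightarrow> \<beta> \<in> Poly_Mapping.keys p \<Longrightarrow> \<beta> \<noteq> lead_exp gt p \<Longrightarrow> gt (lead_exp gt p) \<beta>"
proof -
  have *: "\<exists>\<alpha>\<in>Poly_Mapping.keys p. \<forall>\<beta>\<in>Poly_Mapping.keys p. \<beta> \<noteq> \<alpha> \<longrightarrow> gt \<alpha> \<beta>" if "p \<noteq> 0"
    using that by (intro finite_has_gt_max) auto
  show "p \<noteq> 0 \<Longrightarrow> lead_exp gt p \<in> Poly_Mapping.keys p"
    using * lead_exp_eqI by metis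
  show "p \<noteq> 0 \<Longrightarrow> \<beta> \<in> Poly_Mapping.keys p \<Longrightarrow> \<beta> \<noteq> lead_exp gt p \<Longrightarrow> gt (lead_exp gt p) \<beta>"
    using * lead_exp_eqI by metis
qed

text \<open>The leading terms cancel and all other monomials are smaller. The conditions on
  \<open>q\<close> fit both branches of a division step: the leading term itself and a multiple of a
  divisor.\<close>

lemma lead_exp_diff_less:
  fixes p q :: "('n, 'a::ab_group_add) mpoly"
  assumes "p \<noteq> 0" "Poly_Mapping.lookup q (lead_exp gt p) = Poly_Mapping.lookup p (lead_exp gt p)"
    and "\<And>\<beta>. \<beta> \<in> Poly_Mapping.keys q \<Longrightarrow> \<beta> \<noteq> lead_exp gt p \<Longrightarrow> gt (lead_exp gt p) \<beta>"
    and "p - q \<noteq> 0"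
  shows "gt (lead_exp gt p) (lead_exp gt (p - q))"
proof -
  let ?l = "lead_exp gt (p - q)"
  have l: "Poly_Mapping.lookup p ?l \<noteq> Poly_Mapping.lookup q ?l"
    using lead_exp_in_keys[OF assms(4)] by (simp add: in_keys_iff lookup_minus)
  then have "?l \<noteq> lead_exp gt p"
    using assms(2) by auto
  moreover from l have "?l \<in> Poly_Mapping.keys p \<or> ?l \<in> Poly_Mapping.keys q"
    by (auto simp: in_keys_iff)
  ultimately show ?thesis
    using gt_lead_exp[OF assms(1)] assms(3) by blast
qed

text \<open>The leading term of \<open>g\<close> lies in the monomial ideal generated by the leading
  terms of \<open>U\<close>, to which the membership criterion applies.\<close>

lemma groebner_basis_exp_dvd:
  assumes "groebner_basis gt U I" "g \<in> I" "g \<noteq> (0 :: ('n, 'a::field) mpoly)"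
  shows "\<exists>u\<in>U. u \<noteq> 0 \<and> exp_dvd (lead_exp gt u) (lead_exp gt g)"
proof -
  have "lead_term gt g \<in> poly_ideal.span (lead_term gt ` (U - {0}))"
    using assms by (auto simp: groebner_basis_def intro: poly_ideal.span_base)
  moreover have "lead_exp gt g \<in> Poly_Mapping.keys (lead_term gt g)"
    using lead_exp_in_keys[OF assms(3)] by (simp add: lead_term_def lead_coef_def in_keys_iff)
  ultimately show ?thesis
    unfolding lead_term_def[abs_def] using keys_span_single_exp_dvd by fastforce
qed

section \<open>Termination and correctness of the division algorithm\<close>

lemma division_step_decreases:
  assumes "p \<noteq> (0 :: ('n, 'a::field) mpoly)" "division_step gt us (p, r) = (p', r')" "p' \<noteq> 0"
  shows "gt (lead_exp gt p) (lead_exp gt p')"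
proof (cases "find (\<lambda>u. u \<noteq> 0 \<and> exp_dvd (lead_exp gt u) (lead_exp gt p)) us")
  case None
  then have p': "p' = p - lead_term gt p"
    using assms(2) by (simp add: division_step_def)
  show ?thesis
    unfolding p' by (rule lead_exp_diff_less)
      (use assms p' in \<open>auto simp: lead_term_def lead_coef_def split: if_splits\<close>)
next
  case (Some u)
  then have u: "u \<noteq> 0" "exp_dvd (lead_exp gt u) (lead_exp gt p)"
    by (auto simp: find_Some_iff)
  \<comment> \<open>The quotient term shifts the leading exponent of \<open>u\<close> to that of
    \<open>p\<close> and rescales its coefficient to match.\<close>
  let ?d = "lead_exp gt p - lead_exp gt u"
  let ?t = "Poly_Mapping.single ?d (lead_coef gt p / lead_coef gt u)"
  from Some have p': "p' = p - ?t * u"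
    using assms(2) by (simp add: division_step_def)
  have lp: "?d + lead_exp gt u = lead_exp gt p"
    using u(2) by (rule exp_dvd_imp_add)
  have "lead_coef gt u \<noteq> 0"
    using lead_exp_in_keys[OF u(1)] by (simp add: lead_coef_def in_keys_iff)
  then have "Poly_Mapping.lookup (?t * u) (lead_exp gt p) = Poly_Mapping.lookup p (lead_exp gt p)"
    using lookup_single_mult[of ?d _ u "lead_exp gt u"] lp by (simp add: lead_coef_def)
  moreover have "gt (lead_exp gt p) \<beta>"
    if \<beta>: "\<beta> \<in> Poly_Mapping.keys (?t * u)" "\<beta> \<noteq> lead_exp gt p" for \<beta>
  proof -
    from \<beta>(1) keys_mult[of ?t u] obtain \<gamma> where \<gamma>: "\<gamma> \<in> Poly_Mapping.keys u" "\<beta> = ?d + \<gamma>"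
      by (auto split: if_splits)
    with \<beta>(2) lp have "\<gamma> \<noteq> lead_exp gt u"
      by auto
    with gt_lead_exp[OF u(1) \<gamma>(1)] gt_add[of "lead_exp gt u" \<gamma> ?d] lp \<gamma>(2) show ?thesis
      by (simp add: add.commute)
  qed
  ultimately show ?thesis
    unfolding p' using assms(1,3) p' by (intro lead_exp_diff_less) auto
qed

lemma division_remainder_correct:
  fixes f :: "('n, 'a::field) mpoly"
  assumes I: "poly_ideal.subspace I" and us: "set us \<subseteq> I"
  shows "f - division_remainder gt us f \<in> I \<and>
    (\<forall>\<alpha>\<in>Poly_Mapping.keys (division_remainder gt us f). \<forall>u\<in>set us. u \<noteq> 0 \<longrightarrow> \<not> exp_dvd (lead_exp gt u) \<alpha>)"
proof -
  let ?red = "\<lambda>r. \<forall>\<alpha>\<in>Poly_Mapping.keys r. \<forall>u\<in>set us. u \<noteq> 0 \<longrightarrow> \<not> exp_dvd (lead_exp gt u) \<alpha>"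
  \<comment> \<open>Loop invariant: \<open>p + r\<close> is congruent to \<open>f\<close> modulo
    \<open>I\<close>, and \<open>r\<close> is already reduced.\<close>
  define P where "P = (\<lambda>(p, r). f - p - r \<in> I \<and> ?red r)"
  let ?b = "\<lambda>(p, r). p \<noteq> 0" and ?c = "division_step gt us"
  \<comment> \<open>\<open>lead_exp\<close> is meaningless at 0, so the first component drops when
    the dividend becomes 0; otherwise the leading exponent decreases.\<close>
  let ?r = "inv_image (less_than <*lex*> {(\<beta>, \<alpha>). gt \<alpha> \<beta>})
    (\<lambda>(p :: ('n, 'a) mpoly, r :: ('n, 'a) mpoly). (if p = 0 then 0 else 1 :: nat, lead_exp gt p))"
  have "f - snd (while ?b ?c (f, 0)) \<in> I \<and> ?red (snd (while ?b ?c (f, 0)))"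
  proof (rule while_rule[where P = P and r = ?r])
    show "P (f, 0)"
      using poly_ideal.subspace_0[OF I] by (simp add: P_def)
    show "wf ?r"
      by (intro wf_inv_image wf_lex_prod wf_less_than wf_gt)
    show "f - snd s \<in> I \<and> ?red (snd s)" if "P s" "\<not> ?b s" for s
      using that by (auto simp: P_def)
    fix s :: "('n, 'a) mpoly \<times> ('n, 'a) mpoly"
    assume s: "P s" "?b s"
    obtain p r where pr: "s = (p, r)"
      by fastforce
    obtain p' r' where pr': "?c s = (p', r')"
      by fastforce
    show "(?c s, s) \<in> ?r"
      using s division_step_decreases[of p us r p' r'] pr pr' by auto
    from s pr have p: "p \<noteq> 0" and inv: "f - p - r \<in> I" "?red r"
      by (auto simp: P_def)
    show "P (?c s)"
    proof (cases "find (\<lambda>u. u \<noteq> 0 \<and> exp_dvd (lead_exp gt u) (lead_exp gt p)) us")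
      case None
      \<comment> \<open>The failed search says that no divisor's leading exponent divides the moved
        term; the sum \<open>p + r\<close> is unchanged.\<close>
      then have "?red (lead_term gt p)"
        by (auto simp: find_None_iff lead_term_def split: if_splits)
      with inv(2) have "?red (r + lead_term gt p)"
        using Poly_Mapping.keys_add[of r "lead_term gt p"] by blast
      moreover have "f - (p - lead_term gt p) - (r + lead_term gt p) = f - p - r"
        by simp
      with inv(1) have "f - (p - lead_term gt p) - (r + lead_term gt p) \<in> I"
        by (simp only:)
      ultimately show ?thesis
        unfolding pr P_def division_step_def using None by simp
    next
      case (Some u)
      then have u: "u \<in> I"
        using us by (auto simp: find_Some_iff)
      \<comment> \<open>Cancellation changes \<open>f - p - r\<close> only by a multiple of
        \<open>u\<close>, which lies in \<open>I\<close>.\<close>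
      have "f - (p - t * u) - r \<in> I" for t
      proof -
        have "f - (p - t * u) - r = (f - p - r) + t * u"
          by simp
        then show ?thesis
          using poly_ideal.subspace_add[OF I inv(1) poly_ideal.subspace_scale[OF I u, of t]]
          by (simp only:)
      qed
      with Some inv(2) show ?thesis
        by (simp add: division_step_def pr P_def)
    qed
  qed
  then show ?thesis
    by (simp add: division_remainder_def)
qed

text \<open>By the power identity \<open>\<tau>\<^sub>j\<^sup>q - \<tau>\<^sub>j\<close> vanishes
  everywhere. Some divisor's leading exponent divides that of \<open>\<tau>\<^sub>j\<^sup>q\<close>,
  so no monomial of the remainder reaches degree \<open>q\<close> in a variable.\<close>

lemma division_remainder_bounded:
  fixes f :: "('n, 'a::{finite,field}) mpoly"
  assumes "groebner_basis gt (set us) (vanishing_ideal X)"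
  shows "division_remainder gt us f \<in> bounded_polys CARD('a)"
proof -
  let ?q = "CARD('a)"
  have "Poly_Mapping.lookup \<alpha> j < ?q"
    if \<alpha>: "\<alpha> \<in> Poly_Mapping.keys (division_remainder gt us f)" for \<alpha> j
  proof (rule ccontr)
    assume large: "\<not> Poly_Mapping.lookup \<alpha> j < ?q"
    let ?e = "\<lambda>k. Poly_Mapping.single j k :: 'n exponent"
    define g :: "('n, 'a) mpoly" where
      "g = Poly_Mapping.single (?e ?q) 1 - Poly_Mapping.single (?e 1) 1"
    have q: "1 < ?q"
      by (rule card_field_gt_1)
    \<comment> \<open>The difference \<open>?e (?q - 1)\<close> is nonzero because
      \<open>?q > 1\<close>, hence above 0; translating by \<open>?e 1\<close> compares the two
      exponents of \<open>g\<close>.\<close>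
    have "?e (?q - 1) + ?e 1 = ?e ?q"
      using q by (simp flip: single_add)
    moreover have "?e (?q - 1) \<noteq> 0"
      using q by (metis keys_eq_empty keys_single insert_not_empty zero_less_diff less_numeral_extra(3))
    ultimately have gt_e: "gt (?e ?q) (?e 1)"
      using gt_add[OF gt_zero, of "?e (?q - 1)" "?e 1"] by simp
    then have ne: "?e ?q \<noteq> ?e 1"
      using gt_irrefl by metis
    have key: "?e ?q \<in> Poly_Mapping.keys g"
      using ne by (simp add: g_def in_keys_iff lookup_minus lookup_single when_def)
    have "lead_exp gt g = ?e ?q"
    proof (rule lead_exp_eqI[OF key])
      show "gt (?e ?q) \<beta>" if "\<beta> \<in> Poly_Mapping.keys g" "\<beta> \<noteq> ?e ?q" for \<beta>
        using that gt_e
        by (auto simp: g_def in_keys_iff lookup_minus lookup_single when_def split: if_splits)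
    qed
    moreover have "monomial_function (?e k) x = x j ^ k" for k and x :: "'n \<Rightarrow> 'a"
    proof -
      have "monomial_function (?e k) x = (\<Prod>i\<in>UNIV. if i = j then x j ^ k else 1)"
        unfolding monomial_function_def
        by (rule prod.cong) (auto simp: lookup_single when_def)
      then show ?thesis
        by simp
    qed
    then have "g \<in> vanishing_ideal X"
      by (simp add: vanishing_ideal_def g_def poly_function_diff finite_field_power_card_eq_same)
    moreover have "g \<noteq> 0"
      using key by auto
    ultimately obtain u where u: "u \<in> set us" "u \<noteq> 0" "exp_dvd (lead_exp gt u) (?e ?q)"
      using groebner_basis_exp_dvd[OF assms] by metis
    have "exp_dvd (?e ?q) \<alpha>"
      using large by (auto simp: lookup_single when_def)
    with u(3) have "exp_dvd (lead_exp gt u) \<alpha>"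
      using order_trans by blast
    moreover have "set us \<subseteq> vanishing_ideal X"
      using assms by (simp add: groebner_basis_def)
    ultimately show False
      using u(1,2) \<alpha> division_remainder_correct[OF subspace_vanishing_ideal] by blast
  qed
  then show ?thesis
    by (auto simp: bounded_polys_def bounded_exponents_def)
qed

end


section \<open>Orthogonal solutions\<close>

text \<open>The definition asks for linearity in the first argument; symmetry carries it to the
  second.\<close>

lemma symmetric_bilinear_form_linear:
  "symmetric_bilinear_form B \<Longrightarrow> Vector_Spaces.linear fscale (*) (B f)"
  unfolding symmetric_bilinear_form_def by (metis (no_types, lifting) ext)

lemma orthonormal_list_appendD1:
  assumes "orthonormal_list B (us @ ts)"
  shows "orthonormal_list B us"
  unfolding orthonormal_list_def
proof (intro allI impI)
  fix i j assume "i < length us" "j < length us"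
  then show "B (us ! i) (us ! j) = (if i = j then 1 else 0)"
    using assms[unfolded orthonormal_list_def, rule_format, of i j] by (simp add: nth_append)
qed

text \<open>Over a finite field \<open>B w w = 0\<close> need not force \<open>w = 0\<close>. The
  orthonormal list replaces definiteness: pairing with \<open>u\<close> reads off the coefficient of
  \<open>u\<close> in \<open>w\<close>.\<close>

lemma orthonormal_list_span_eq_0:
  assumes B: "symmetric_bilinear_form B" and on: "orthonormal_list B us"
    and w: "w \<in> fun_space.span (set us)" "\<And>u. u \<in> set us \<Longrightarrow> B u w = 0"
  shows "w = 0"
proof -
  obtain c where c: "w = (\<Sum>u\<in>set us. fscale (c u) u)"
    using w(1) by (auto simp: fun_space.span_finite)
  have "c u = 0" if u: "u \<in> set us" for u
  proof -
    interpret L: Vector_Spaces.linear fscale "(*)" "B u"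
      by (rule symmetric_bilinear_form_linear[OF B])
    have "B u v = (if v = u then 1 else 0)" if "v \<in> set us" for v
      using on u that by (auto simp: orthonormal_list_def in_set_conv_nth)
    then have "B u w = (\<Sum>v\<in>set us. if v = u then c u else 0)"
      unfolding c L.sum L.scale by (intro sum.cong) auto
    with u w(2)[OF u] show ?thesis
      by simp
  qed
  then show ?thesis
    by (simp add: c)
qed

text \<open>A row of the coordinate matrix is the coefficient list of a polynomial in the vanishing ideal;
  its pivot is the leading exponent, because the columns are ordered decreasingly.\<close>

lemma pivot_column_lead_exp:
  fixes X :: "'m \<Rightarrow> 'n::finite \<Rightarrow> 'a::{finite,field}"
  assumes order: "monomial_order gt"
    and \<alpha>s: "set \<alpha>s = bounded_exponents CARD('a)" "sorted_wrt gt \<alpha>s"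
    and us: "set us \<subseteq> evaluation_kernel X"
    and j: "j \<in> pivot_columns (coord_matrix (map monomial_function \<alpha>s) us)"
  obtains g where "g \<in> vanishing_ideal (range X)" "g \<noteq> 0" "lead_exp gt g = \<alpha>s ! j"
proof -
  let ?M = "monomial_function ` bounded_exponents CARD('a) :: (('n \<Rightarrow> 'a) \<Rightarrow> 'a) set"
  from j obtain i where jl: "j < length \<alpha>s" and i: "i < length us"
    and piv: "fun_space.representation ?M (us ! i) (monomial_function (\<alpha>s ! j)) \<noteq> 0"
    and zero: "\<And>k. k < j \<Longrightarrow> fun_space.representation ?M (us ! i) (monomial_function (\<alpha>s ! k)) = 0"
    by (auto simp: pivot_columns_def coord_matrix_def \<alpha>s(1))
  \<comment> \<open>Row \<open>i\<close> read as a coefficient family; its function is the kernel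
    element \<open>us ! i\<close>.\<close>
  define g where "g = poly_of_coeffs (\<lambda>\<alpha>. fun_space.representation ?M (us ! i) (monomial_function \<alpha>))"
  have "poly_function g = us ! i"
    unfolding g_def poly_function_poly_of_coeffs_image
    by (intro fun_space.sum_representation_eq independent_monomial_functions)
       (auto simp: span_monomial_functions)
  moreover have "us ! i \<in> evaluation_kernel X"
    using us i by auto
  ultimately have "g \<in> vanishing_ideal (range X)"
    by (auto simp: vanishing_ideal_def evaluation_kernel_def evaluation_def fun_eq_iff)
  moreover have key: "\<alpha>s ! j \<in> Poly_Mapping.keys g"
    using piv jl \<alpha>s(1)[symmetric] by (simp add: g_def in_keys_iff lookup_poly_of_coeffs)
  then have "g \<noteq> 0"
    by auto
  moreover have "lead_exp gt g = \<alpha>s ! j"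
  proof (rule lead_exp_eqI[OF order key])
    fix \<beta>
    assume \<beta>: "\<beta> \<in> Poly_Mapping.keys g" "\<beta> \<noteq> \<alpha>s ! j"
    then have "\<beta> \<in> set \<alpha>s" and nz: "fun_space.representation ?M (us ! i) (monomial_function \<beta>) \<noteq> 0"
      by (auto simp: g_def in_keys_iff lookup_poly_of_coeffs \<alpha>s(1) split: if_splits)
    then obtain k where k: "k < length \<alpha>s" "\<beta> = \<alpha>s ! k"
      by (auto simp: in_set_conv_nth)
    \<comment> \<open>Entries left of the pivot vanish, so any other monomial of \<open>g\<close>
      belongs to a later column, which is lower in the order.\<close>
    with nz zero \<beta>(2) have "j < k"
      by (metis linorder_neqE_nat)
    with k \<alpha>s(2) show "gt (\<alpha>s ! j) \<beta>"
      by (simp add: sorted_wrt_iff_nth_less)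
  qed
  ultimately show thesis
    by (rule that)
qed

text \<open>A non-pivot \<open>F ! j\<close> is among the vectors appended after \<open>us\<close>,
  so it and \<open>u\<close> occupy different positions of the orthonormal list.\<close>

lemma standard_extension_orthogonal:
  assumes on: "orthonormal_list B (standard_extension F us)" and "u \<in> set us"
    and j: "j < length F" "j \<notin> pivot_columns (coord_matrix F us)"
  shows "B u (F ! j) = 0"
proof -
  define ts where "ts = [F ! j. j \<leftarrow> [0..<length F], j \<notin> pivot_columns (coord_matrix F us)]"
  have ext: "standard_extension F us = us @ ts"
    by (simp add: standard_extension_def ts_def)
  have "F ! j \<in> set ts"
    using j by (auto simp: ts_def)
  then obtain k where k: "k < length ts" "F ! j = ts ! k"
    by (metis in_set_conv_nth)
  obtain i where i: "i < length us" "u = us ! i"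
    using assms(2) by (auto simp: in_set_conv_nth)
  have "B ((us @ ts) ! i) ((us @ ts) ! (length us + k)) = 0"
    using on[unfolded ext orthonormal_list_def, rule_format, of i "length us + k"] i(1) k(1) by simp
  then show ?thesis
    using i k by (simp add: nth_append)
qed

theorem theorem31:
  fixes gt :: "'n::finite exponent \<Rightarrow> 'n exponent \<Rightarrow> bool"
    and \<alpha>s :: "'n exponent list"
    and X :: "'m::finite \<Rightarrow> ('n \<Rightarrow> 'a::{finite,field})"
    and b :: "'m \<Rightarrow> 'a"
    and F us :: "(('n \<Rightarrow> 'a) \<Rightarrow> 'a) list"
    and B :: "(('n \<Rightarrow> 'a) \<Rightarrow> 'a) \<Rightarrow> (('n \<Rightarrow> 'a) \<Rightarrow> 'a) \<Rightarrow> 'a"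
    and f :: "('n, 'a) mpoly"
    and U :: "('n, 'a) mpoly list"
    and v :: "('n \<Rightarrow> 'a) \<Rightarrow> 'a"
  assumes "CARD('m) < CARD('a) ^ CARD('n)"
    and "monomial_order gt"
    and "set \<alpha>s = bounded_exponents CARD('a)" and "sorted_wrt gt \<alpha>s"
    and "F = map monomial_function \<alpha>s"
    and "inj X"
    and "cleaned_kernel_basis F (evaluation_kernel X) us"
    and "symmetric_bilinear_form B" and "orthonormal_list B (standard_extension F us)"
    and "\<forall>j. poly_function f (X j) = b j"
    and "groebner_basis gt (set U) (vanishing_ideal (range X))"
    and "orthogonal_solution B X b v"
  shows "poly_of_function v = division_remainder gt U f"
proof -
  note order = assms(2) and \<alpha>s = assms(3,4) and F = assms(5) and B = assms(8) and on = assms(9)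
    and groebner = assms(11)
  define r where "r = division_remainder gt U f"
  let ?w = "v - poly_function r"
  have kernel: "fun_space.span (set us) = evaluation_kernel X"
    using assms(7) by (simp add: cleaned_kernel_basis_def ordered_basis_def)
  then have us_kernel: "set us \<subseteq> evaluation_kernel X"
    using fun_space.span_superset by blast
  have "set U \<subseteq> vanishing_ideal (range X)"
    using groebner by (simp add: groebner_basis_def)
  then have r: "f - r \<in> vanishing_ideal (range X)"
    and red: "\<And>\<alpha> u. \<alpha> \<in> Poly_Mapping.keys r \<Longrightarrow> u \<in> set U \<Longrightarrow> u \<noteq> 0 \<Longrightarrow> \<not> exp_dvd (lead_exp gt u) \<alpha>"
    using division_remainder_correct[OF order subspace_vanishing_ideal, of U "range X" f]
    by (auto simp: r_def)
  have bounded: "r \<in> bounded_polys CARD('a)"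
    unfolding r_def by (rule division_remainder_bounded[OF order groebner])
  \<comment> \<open>At the points \<open>v\<close> and \<open>f\<close> both take the values
    \<open>b\<close>, and \<open>f - r\<close> vanishes there.\<close>
  have w: "?w \<in> evaluation_kernel X"
    using r assms(10,12)
    by (auto simp: vanishing_ideal_def evaluation_kernel_def evaluation_def orthogonal_solution_def
        poly_function_diff fun_eq_iff)
  have r_orth: "B u (poly_function r) = 0" if u: "u \<in> set us" for u
  proof -
    interpret L: Vector_Spaces.linear fscale "(*)" "B u"
      by (rule symmetric_bilinear_form_linear[OF B])
    have "B u (monomial_function \<alpha>) = 0" if \<alpha>: "\<alpha> \<in> Poly_Mapping.keys r" for \<alpha>
    proof -
      have "\<alpha> \<in> set \<alpha>s"
        using \<alpha> bounded by (auto simp: \<alpha>s(1) bounded_polys_def)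
      then obtain j where j: "j < length \<alpha>s" "\<alpha> = \<alpha>s ! j"
        by (auto simp: in_set_conv_nth)
      have "j \<notin> pivot_columns (coord_matrix F us)"
      proof
        \<comment> \<open>A pivot exponent is divisible by the leading exponent of a nonzero member
          of \<open>U\<close>, unlike any monomial of the remainder.\<close>
        assume "j \<in> pivot_columns (coord_matrix F us)"
        then obtain g where "g \<in> vanishing_ideal (range X)" "g \<noteq> 0" "lead_exp gt g = \<alpha>"
          using pivot_column_lead_exp[OF order \<alpha>s us_kernel] j(2) unfolding F by metis
        then show False
          using groebner_basis_exp_dvd[OF order groebner] red[OF \<alpha>] by metis
      qed
      then have "B u (F ! j) = 0"
        by (intro standard_extension_orthogonal[OF on u]) (use j F in auto)
      then show ?thesis
        using j F by simp
    qed
    moreover have "poly_function r =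
        (\<Sum>\<alpha>\<in>Poly_Mapping.keys r. fscale (Poly_Mapping.lookup r \<alpha>) (monomial_function \<alpha>))"
      by (simp add: fun_eq_iff poly_function_def sum_fun_apply fscale_def)
    ultimately show ?thesis
      by (simp add: L.sum L.scale)
  qed
  have "B u ?w = 0" if u: "u \<in> set us" for u
  proof -
    interpret L: Vector_Spaces.linear fscale "(*)" "B u"
      by (rule symmetric_bilinear_form_linear[OF B])
    have "B u v = 0"
      using assms(12) us_kernel u by (auto simp: orthogonal_solution_def)
    with r_orth[OF u] show ?thesis
      by (simp add: L.diff)
  qed
  moreover have "orthonormal_list B us"
    using on unfolding standard_extension_def by (rule orthonormal_list_appendD1)
  ultimately have "?w = 0"
    using orthonormal_list_span_eq_0[OF B] w kernel by blast
  then have "v = poly_function r"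
    by simp
  \<comment> \<open>Since \<open>r\<close> is reduced, injectivity recovers it from its function
    \<open>v\<close>.\<close>
  then show ?thesis
    using poly_of_function_poly_function[OF bounded] by (simp add: r_def)
qed

end
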